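(* Let $f:\mathbb{C}\to\mathbb{C}$ be an entire function that is neither constant nor a polynomial of degree $1$, and let $U\subset\mathbb{C}$ be an open set intersecting the Julia set $J(f)$ of $f$. Then for any $R>0$ there exists $m\in\mathbb{N}$ such that $$\mu(U,f^n)\geq \log M^{n-m}(R,f)$$ for all sufficiently large $n$.
   Context: $f^n$ denotes the $n$-th iterate of $f$. The Julia set $J(f)$ is the set of all points of $\mathbb{C}$ having no neighborhood in which the iterates $(f^n)_{n\in\mathbb{N}}$ form a normal family. For an entire function $g$, the spherical derivative is $g^\#(z)=\frac{|g'(z)|}{1+|g(z)|^2}$, and $\mu(U,g)=\sup_{z\in U} g^\#(z)$. The maximum modulus is $M(r,f)=\max_{|z|=r}|f(z)|$, and $M^n(r,f)$ denotes its iterate with respect to the first variable: $M^1(r,f)=M(r,f)$ and $M^{n+1}(r,f)=M(M^n(r,f),f)$. *)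

theory Defs
  imports "HOL-Complex_Analysis.Complex_Analysis"
begin

text \<open>The Riemann sphere is modelled as the unit sphere of \<open>complex \<times> real\<close>. Inverse
  stereographic projection embeds the plane in it, the north pole \<open>(0, 1)\<close> playing the role
  of \<open>\<infinity>\<close>, and the Euclidean distance pulls back to the chordal metric.\<close>

definition riemann_embed :: "complex \<Rightarrow> complex \<times> real" where
  "riemann_embed z = (2 * z / of_real (1 + (norm z)\<^sup>2), ((norm z)\<^sup>2 - 1) / ((norm z)\<^sup>2 + 1))"

lemma norm_riemann_embed: "norm (riemann_embed z) = 1"
proof -
  define t where "t = (norm z)\<^sup>2"
  have t: "0 \<le> t" by (simp add: t_def)
  have a: "norm (2 * z / of_real (1 + t)) = 2 * norm z / (1 + t)"
    using t by (simp add: norm_divide norm_mult del: of_real_add)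
  have "(2 * norm z / (1 + t))\<^sup>2 + ((t - 1) / (t + 1))\<^sup>2 = (4 * t + (t - 1)\<^sup>2) / (1 + t)\<^sup>2"
    by (simp add: power_divide power_mult_distrib t_def add_divide_distrib add.commute)
  also have "4 * t + (t - 1)\<^sup>2 = (1 + t)\<^sup>2" by (simp add: power2_eq_square algebra_simps)
  finally show ?thesis
    using t by (simp add: riemann_embed_def norm_Pair a power_divide del: of_real_add flip: t_def)
qed

lemma dist_riemann_embed:
  "dist (riemann_embed z) (riemann_embed w) =
     2 * norm (z - w) / (sqrt (1 + (norm z)\<^sup>2) * sqrt (1 + (norm w)\<^sup>2))"
proof -
  obtain a b where z: "z = Complex a b" by (cases z)
  obtain c d where w: "w = Complex c d" by (cases w)
  define s where "s = 1 + a\<^sup>2 + b\<^sup>2"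
  define t where "t = 1 + c\<^sup>2 + d\<^sup>2"
  have pos: "s > 0" "t > 0"
    unfolding s_def t_def by (smt (verit) zero_le_power2)+
  have nz: "(norm z)\<^sup>2 = s - 1" and nw: "(norm w)\<^sup>2 = t - 1"
    by (simp_all add: z w s_def t_def cmod_power2)
  have ez: "riemann_embed z = (Complex (2 * a / s) (2 * b / s), 1 - 2 / s)"
    using pos by (simp add: riemann_embed_def nz[unfolded z] complex_eq_iff z Re_divide_of_real
        Im_divide_of_real field_simps del: of_real_add of_real_diff)
  have ew: "riemann_embed w = (Complex (2 * c / t) (2 * d / t), 1 - 2 / t)"
    using pos by (simp add: riemann_embed_def nw[unfolded w] complex_eq_iff w Re_divide_of_real
        Im_divide_of_real field_simps del: of_real_add of_real_diff)
  have "(dist (riemann_embed z) (riemann_embed w))\<^sup>2 =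
      (2 * a / s - 2 * c / t)\<^sup>2 + (2 * b / s - 2 * d / t)\<^sup>2 + (2 / t - 2 / s)\<^sup>2"
    by (simp add: ez ew dist_norm norm_Pair cmod_power2)
  also have "\<dots> = 4 * ((a * t - c * s)\<^sup>2 + (b * t - d * s)\<^sup>2 + (s - t)\<^sup>2) / (s * t)\<^sup>2"
    using pos by (simp add: field_simps power2_eq_square)
  also have "(a * t - c * s)\<^sup>2 + (b * t - d * s)\<^sup>2 + (s - t)\<^sup>2 = ((a - c)\<^sup>2 + (b - d)\<^sup>2) * (s * t)"
    unfolding s_def t_def by algebra
  also have "4 * (((a - c)\<^sup>2 + (b - d)\<^sup>2) * (s * t)) / (s * t)\<^sup>2 = 4 * ((a - c)\<^sup>2 + (b - d)\<^sup>2) / (s * t)"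
    using pos by (simp add: power2_eq_square)
  also have "\<dots> = (2 * norm (z - w) / (sqrt s * sqrt t))\<^sup>2"
    using pos by (simp add: power_divide power_mult_distrib z w cmod_power2)
  finally have "dist (riemann_embed z) (riemann_embed w) = 2 * norm (z - w) / (sqrt s * sqrt t)"
    by (rule power2_eq_imp_eq) (use pos in auto)
  then show ?thesis by (simp add: nz nw)
qed

text \<open>Normality is understood with respect to the spherical metric, so \<open>\<infinity>\<close> is admissible as
  a limit. The limit function \<open>g\<close> need not be required to map into the Riemann sphere: the sphere
  is closed, so \<open>g\<close> does so on \<open>V\<close> automatically.\<close>

definition normal_family_on :: "(complex \<Rightarrow> complex) set \<Rightarrow> complex set \<Rightarrow> bool" where
  "normal_family_on F V \<longleftrightarrow>
     (\<forall>h :: nat \<Rightarrow> complex \<Rightarrow> complex. range h \<subseteq> F \<longrightarrow>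
        (\<exists>r g. strict_mono r \<and>
           (\<forall>K. compact K \<and> K \<subseteq> V \<longrightarrow>
              uniform_limit K (\<lambda>k z. riemann_embed (h (r k) z)) g sequentially)))"

definition julia_set :: "(complex \<Rightarrow> complex) \<Rightarrow> complex set" where
  "julia_set f = {z. \<not> (\<exists>V. open V \<and> z \<in> V \<and> normal_family_on (range (\<lambda>n. f ^^ n)) V)}"

definition spherical_deriv :: "(complex \<Rightarrow> complex) \<Rightarrow> complex \<Rightarrow> real" where
  "spherical_deriv g z = norm (deriv g z) / (1 + (norm (g z))\<^sup>2)"

text \<open>The supremum is taken in the extended reals because it may be infinite when \<open>U\<close> is
  unbounded.\<close>

definition sup_spherical_deriv :: "complex set \<Rightarrow> (complex \<Rightarrow> complex) \<Rightarrow> ereal" where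
  "sup_spherical_deriv U g = (SUP z\<in>U. ereal (spherical_deriv g z))"

text \<open>For continuous \<open>f\<close> and \<open>r \<ge> 0\<close> the circle is compact and nonempty, so the supremum is a
  maximum.\<close>

definition max_modulus :: "real \<Rightarrow> (complex \<Rightarrow> complex) \<Rightarrow> real" where
  "max_modulus r f = (SUP z\<in>sphere 0 r. norm (f z))"

definition max_modulus_iter :: "nat \<Rightarrow> real \<Rightarrow> (complex \<Rightarrow> complex) \<Rightarrow> real" where
  "max_modulus_iter n r f = ((\<lambda>s. max_modulus s f) ^^ n) r"

end

theory Submission
  imports Defs
begin

text \<open>
  Why the theorem holds. Let \<open>D\<close> be a small disc in \<open>U\<close> about a point \<open>p\<close> of the Julia set. If the
  entire function \<open>g = f\<^sup>n\<close> takes a value of modulus at most \<open>K\<close> and also a huge value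
  \<open>g w\<close> in \<open>D\<close>, then \<open>g\<close> has a large spherical derivative nearby. Indeed, consider the largest
  disc about \<open>w\<close> on which \<open>|g| > K\<close>. There \<open>ln (|g| / K)\<close> is a positive harmonic function, and it
  vanishes at some boundary point \<open>\<zeta>\<close>. Harnack's inequality forces its normal derivative at
  \<open>\<zeta>\<close> to be at least a constant times \<open>ln (|g w| / K)\<close>; as \<open>|g \<zeta>| = K\<close>, this bounds the
  spherical derivative at \<open>\<zeta>\<close> from below by a constant times \<open>ln (|g w| / K)\<close>
  (\<open>spherical_deriv_lower_bound\<close>).

  It remains to find, for all large \<open>n\<close>, points of \<open>D\<close> where \<open>f\<^sup>n\<close> is bounded by a constant
  independent of \<open>n\<close>, and points where it is as large as \<open>M\<^sup>n\<^sup>-\<^sup>k(R, f)\<close>. Both come from one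
  consequence of Montel's theorem (\<open>julia_set_covering\<close>): if \<open>A\<close> and \<open>B\<close> are disjoint and compact,
  then some \<open>f\<^sup>k\<close> maps \<open>D\<close> onto a superset of \<open>A\<close> or of \<open>B\<close>, for otherwise every \<open>f\<^sup>k\<close> would omit
  two values which stay bounded and apart from each other.

  For bounded values (\<open>julia_set_bounded_minima\<close>) take \<open>A\<close> to be a closed disc about \<open>p\<close> and
  \<open>B = f(A)\<close>, assuming \<open>f(p) \<noteq> p\<close>. With \<open>k \<ge> 2\<close>, both alternatives yield a compact set that some
  iterate maps onto a superset of itself; such a set contains, for every \<open>n\<close>, points which keep
  returning to it for \<open>n\<close> steps. If \<open>f(p) = p\<close>, the orbit of \<open>p\<close> itself is bounded.

  For large values (\<open>julia_set_fast_growth\<close>) take two large circles. One of them is covered by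
  \<open>f\<^sup>k(D)\<close>, so that
  \<open>|f\<^sup>k\<^sup>+\<^sup>j|\<close> reaches \<open>M(\<rho>, f\<^sup>j)\<close> on \<open>D\<close>, and \<open>M(\<rho>, f\<^sup>j)\<close> dominates \<open>M\<^sup>j(R, f)\<close> for large
  \<open>\<rho>\<close> by a Bohr type argument (\<open>max_modulus_funpow_ge_iter\<close>).

  All constants are absorbed into \<open>m\<close>: as \<open>f\<close> is not affine, \<open>ln M(r, f) \<ge> 3/2 ln r\<close> for large
  \<open>r\<close>, so \<open>q\<close> further iterations multiply \<open>ln M\<^sup>j(R, f)\<close> by at least \<open>(3/2)\<^sup>q\<close>.
\<close>

section \<open>Maximum modulus and its iterates\<close>

lemma max_modulus_attained:
  assumes "continuous_on UNIV g" "0 \<le> r"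
  obtains z where "norm z = r" "norm (g z) = max_modulus r g"
    "\<And>w. norm w = r \<Longrightarrow> norm (g w) \<le> max_modulus r g"
proof -
  have ne: "sphere (0::complex) r \<noteq> {}"
    using assms(2) by (auto intro!: exI[of _ "complex_of_real r"])
  have "continuous_on (sphere 0 r) (\<lambda>z. norm (g z))"
    using assms(1) by (intro continuous_on_norm continuous_on_subset[OF assms(1)]) auto
  then obtain z where z: "z \<in> sphere 0 r" "\<And>w. w \<in> sphere 0 r \<Longrightarrow> norm (g w) \<le> norm (g z)"
    using continuous_attains_sup[OF compact_sphere ne] by blast
  have "max_modulus r g = norm (g z)"
    unfolding max_modulus_def
    by (rule cSup_eq_maximum) (use z in auto)
  with z that show thesis by auto
qed

lemma max_modulus_nonneg:
  assumes "continuous_on UNIV g" "0 \<le> r"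
  shows "0 \<le> max_modulus r g"
  by (rule max_modulus_attained[OF assms]) (metis norm_ge_zero)

lemma norm_le_max_modulus:
  assumes g: "g holomorphic_on UNIV" and z: "norm z \<le> r"
  shows "norm (g z) \<le> max_modulus r g"
proof (cases "r > 0")
  case True
  have "norm (g z) \<le> max_modulus r g"
  proof (rule maximum_modulus_frontier[of g "cball 0 r"])
    show "norm (g w) \<le> max_modulus r g" if "w \<in> frontier (cball 0 r)" for w
      using that True max_modulus_attained[OF holomorphic_on_imp_continuous_on[OF g], of r]
      by (metis frontier_cball less_eq_real_def mem_sphere_0)
  qed (use z in \<open>auto intro: holomorphic_on_imp_continuous_on holomorphic_on_subset[OF g]\<close>)
  then show ?thesis .
next
  case False
  then have "norm z = r" "0 \<le> r" using z norm_ge_zero[of z] by linarith+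
  then show ?thesis
    using max_modulus_attained[OF holomorphic_on_imp_continuous_on[OF g], of r] by metis
qed

lemma max_modulus_mono:
  assumes g: "g holomorphic_on UNIV" and "0 \<le> r" "r \<le> s"
  shows "max_modulus r g \<le> max_modulus s g"
  using max_modulus_attained[OF holomorphic_on_imp_continuous_on[OF g] assms(2)]
    norm_le_max_modulus[OF g] assms(3) by metis

lemma max_modulus_iter_0 [simp]: "max_modulus_iter 0 r f = r"
  by (simp add: max_modulus_iter_def)

lemma max_modulus_iter_Suc:
  "max_modulus_iter (Suc n) r f = max_modulus_iter n (max_modulus r f) f"
  by (simp add: max_modulus_iter_def funpow_Suc_right del: funpow.simps)

lemma max_modulus_iter_Suc_outer:
  "max_modulus_iter (Suc n) r f = max_modulus (max_modulus_iter n r f) f"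
  by (simp add: max_modulus_iter_def)

lemma max_modulus_iter_mono:
  assumes f: "f holomorphic_on UNIV" and "0 \<le> r" "r \<le> s"
  shows "0 \<le> max_modulus_iter n r f \<and> max_modulus_iter n r f \<le> max_modulus_iter n s f"
  using assms(2,3)
proof (induction n arbitrary: r s)
  case (Suc n)
  have "0 \<le> max_modulus r f"
    using max_modulus_nonneg[OF holomorphic_on_imp_continuous_on[OF f]] Suc.prems by simp
  moreover have "max_modulus r f \<le> max_modulus s f"
    using max_modulus_mono[OF f] Suc.prems by simp
  ultimately show ?case
    using Suc.IH by (simp add: max_modulus_iter_Suc)
qed simp

lemma holomorphic_on_funpow:
  assumes "f holomorphic_on UNIV"
  shows "(f ^^ n) holomorphic_on UNIV"
proof (induction n)
  case (Suc n)
  then show ?case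
    using holomorphic_on_compose_gen[OF Suc assms] by (simp add: o_def)
qed (simp add: id_def)

section \<open>Functions omitting two values\<close>

text \<open>Schottky's theorem on an arbitrary disc. The library version lives on the closed unit disc, so it
  is applied on the concentric disc of radius \<open>3r/4\<close>, in which \<open>r/2\<close> corresponds to the radius
  \<open>2/3\<close>. The constant depends on nothing, which makes all later bounds uniform in the iterates.\<close>

lemma Schottky_ball:
  obtains C :: real where "C \<ge> 1"
    "\<And>h p r z. \<lbrakk>0 < r; h holomorphic_on ball p r; \<And>x. x \<in> ball p r \<Longrightarrow> h x \<noteq> 0 \<and> h x \<noteq> 1;
        norm (h p) \<le> 2; z \<in> cball p (r / 2)\<rbrakk> \<Longrightarrow> norm (h z) \<le> C"
proof
  define C :: real where "C = exp (pi * exp (pi * (2 + 2 * 2 + 12 * (2/3) / (1 - 2/3))))"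
  show "C \<ge> 1" unfolding C_def by simp
  fix h :: "complex \<Rightarrow> complex" and p z r
  assume r: "0 < r" and hol: "h holomorphic_on ball p r"
    and om: "\<And>x. x \<in> ball p r \<Longrightarrow> h x \<noteq> 0 \<and> h x \<noteq> 1"
    and hp: "norm (h p) \<le> 2" and z: "z \<in> cball p (r / 2)"
  show "norm (h z) \<le> C"
  proof -
    define s where "s = 3/4 * r"
    have s: "s > 0" "s < r" "r = 4/3 * s" using r by (auto simp: s_def)
    define k where "k = (\<lambda>x. h (p + of_real s * x))"
    have inb: "p + of_real s * x \<in> ball p r" if "x \<in> cball 0 1" for x
    proof -
      have "norm (of_real s * x) \<le> s"
        using that s by (simp add: norm_mult mult_left_le)
      then show ?thesis using s by (simp add: dist_norm)
    qed
    have "k holomorphic_on cball 0 1"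
      unfolding k_def
      by (rule holomorphic_on_compose_gen[OF _ hol, unfolded o_def])
         (use inb in \<open>auto intro!: holomorphic_intros\<close>)
    then have "norm (k ((z - p) / of_real s)) \<le> C"
      unfolding C_def
    proof (rule Schottky)
      show "norm (k 0) \<le> 2" using hp by (simp add: k_def)
      show "\<not> (k x = 0 \<or> k x = 1)" if "x \<in> cball 0 1" for x
        using om[OF inb[OF that]] by (simp add: k_def)
      have "norm (z - p) \<le> r / 2" using z by (simp add: dist_norm norm_minus_commute)
      then show "norm ((z - p) / of_real s) \<le> 2/3"
        using s by (simp add: norm_divide field_simps)
    qed auto
    then show ?thesis using s by (simp add: k_def)
  qed
qed

lemma holomorphic_bounded_imp_Lipschitz:
  assumes hol: "h holomorphic_on ball p r" and r: "r > 0"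
    and B: "\<And>x. x \<in> cball p (r / 2) \<Longrightarrow> norm (h x) \<le> B"
    and xy: "x \<in> cball p (r / 4)" "y \<in> cball p (r / 4)"
  shows "norm (h x - h y) \<le> 4 * B / r * norm (x - y)"
proof (rule field_differentiable_bound[OF convex_cball _ _ xy])
  fix z assume z: "z \<in> cball p (r / 4)"
  have sub: "cball z (r / 4) \<subseteq> cball p (r / 2)"
  proof
    fix y assume "y \<in> cball z (r / 4)"
    then show "y \<in> cball p (r / 2)" using dist_triangle[of p y z] z by auto
  qed
  have sub2: "cball p (r / 2) \<subseteq> ball p r" using r by auto
  have "z \<in> ball p r" using z r by auto
  then show "(h has_field_derivative deriv h z) (at z within cball p (r / 4))"
    using hol by (meson holomorphic_derivI open_ball)
  have "norm ((deriv ^^ 1) h z) \<le> fact 1 * B / (r / 4) ^ 1"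
  proof (rule Cauchy_inequality)
    show "h holomorphic_on ball z (r / 4)"
      using sub sub2 ball_subset_cball[of z "r / 4"]
      by (intro holomorphic_on_subset[OF hol]) blast
    show "continuous_on (cball z (r / 4)) h"
      using sub sub2 by (intro continuous_on_subset[OF holomorphic_on_imp_continuous_on[OF hol]]) blast
    show "norm (h x) \<le> B" if "norm (z - x) = r / 4" for x
      using that sub by (intro B) (auto simp: dist_norm)
  qed (use r in auto)
  then show "norm (deriv h z) \<le> 4 * B / r" by (simp add: mult.commute)
qed

lemma dist_riemann_embed_le: "dist (riemann_embed z) (riemann_embed w) \<le> 2 * norm (z - w)"
proof -
  have "1 * 1 \<le> sqrt (1 + (norm z)\<^sup>2) * sqrt (1 + (norm w)\<^sup>2)"
    by (intro mult_mono) auto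
  then show ?thesis
    unfolding dist_riemann_embed using frac_le[of "2 * norm (z - w)" "2 * norm (z - w)" 1] by simp
qed

text \<open>The chordal metric does not see the pole at \<open>e = 0\<close>: writing \<open>a + c/e\<close> as the homogeneous pair
  \<open>(a e + c, e)\<close>, the distance of two such points is twice the norm of the determinant \<open>c (e - e')\<close>
  divided by the norms of the two pairs. These norms are at least \<open>\<delta> / (S + 1)\<close>, since \<open>a e + c\<close> and
  \<open>e\<close> cannot both be small when \<open>|c| \<ge> \<delta>\<close>. This allows values of \<open>h\<close> near \<open>\<infinity>\<close> to be controlled by
  the reciprocal of the normalised function.\<close>

lemma dist_riemann_embed_Mobius_le:
  assumes e: "e \<noteq> 0" "e' \<noteq> 0" and a: "norm a \<le> S" and c: "\<delta> \<le> norm c" "\<delta> > 0"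
  shows "dist (riemann_embed (a + c / e)) (riemann_embed (a + c / e'))
     \<le> 2 * norm c * (S + 1)\<^sup>2 / \<delta>\<^sup>2 * norm (e - e')"
proof -
  have S: "S \<ge> 0" using a norm_ge_zero[of a] by linarith
  have key: "\<delta> / (S + 1) \<le> norm e * sqrt (1 + (norm (a + c / e))\<^sup>2)" if "e \<noteq> 0" for e
  proof -
    define q where "q = sqrt (1 + (norm (a + c / e))\<^sup>2)"
    have q: "1 \<le> q" "norm (a + c / e) \<le> q"
      unfolding q_def by (auto intro: real_le_rsqrt)
    have "c = e * (a + c / e) - a * e" using that by (simp add: algebra_simps)
    then have "norm c \<le> norm e * norm (a + c / e) + norm a * norm e"
      by (metis norm_mult norm_triangle_ineq4)
    also have "\<dots> \<le> norm e * q + S * (norm e * q)"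
    proof (intro add_mono mult_left_mono q)
      have "norm a * norm e \<le> S * norm e" using a by (intro mult_right_mono) auto
      also have "\<dots> \<le> S * (norm e * q)"
        using S q mult_left_mono[of 1 q "norm e"] by (intro mult_left_mono) auto
      finally show "norm a * norm e \<le> S * (norm e * q)" .
    qed auto
    finally have "\<delta> \<le> (norm e * q) * (S + 1)" using c by (simp add: algebra_simps)
    then show ?thesis using S unfolding q_def by (simp add: pos_divide_le_eq)
  qed
  define Q where "Q = sqrt (1 + (norm (a + c / e))\<^sup>2) * sqrt (1 + (norm (a + c / e'))\<^sup>2)"
  have Q: "Q > 0" unfolding Q_def
    by (smt (verit) mult_pos_pos real_sqrt_gt_zero zero_le_power2)
  have "(\<delta> / (S + 1)) * (\<delta> / (S + 1)) \<le> norm e * norm e' * Q"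
    using mult_mono[OF key[OF e(1)] key[OF e(2)]] S c e
    unfolding Q_def by (simp add: mult_ac)
  then have Q2: "\<delta>\<^sup>2 \<le> (S + 1)\<^sup>2 * (norm e * norm e' * Q)"
    using S by (simp add: power2_eq_square pos_divide_le_eq mult_ac)
  have "(a + c / e) - (a + c / e') = c * (e' - e) / (e * e')"
    using e by (simp add: field_simps)
  then have "norm ((a + c / e) - (a + c / e')) = norm c * norm (e - e') / (norm e * norm e')"
    by (simp add: norm_mult norm_divide norm_minus_commute)
  then have "dist (riemann_embed (a + c / e)) (riemann_embed (a + c / e'))
      = 2 * norm c * norm (e - e') / (norm e * norm e' * Q)"
    unfolding dist_riemann_embed Q_def by simp
  also have "\<dots> \<le> 2 * norm c * norm (e - e') / (\<delta>\<^sup>2 / (S + 1)\<^sup>2)"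
    using Q2 S c e Q by (intro divide_left_mono) (auto simp: field_simps)
  also have "\<dots> = 2 * norm c * (S + 1)\<^sup>2 / \<delta>\<^sup>2 * norm (e - e')"
    by simp
  finally show ?thesis .
qed

text \<open>The quantitative form of Montel's theorem with omitted values varying from function to function.
  Normalise to \<open>H = (h - a) / (b - a)\<close>, which omits 0 and 1. Then Schottky's theorem applies to \<open>H\<close>
  or to \<open>1 / H\<close>, according to whether \<open>|H p| \<le> 1\<close>, and Cauchy's estimate makes the bounded one
  Lipschitz.\<close>

lemma omitting_two_values_imp_spherical_Lipschitz:
  assumes r: "r > 0" and S: "S \<ge> 0" and \<delta>: "\<delta> > 0"
  obtains L where "\<And>h p a b x y. \<lbrakk>h holomorphic_on ball p r; a \<notin> h ` ball p r; b \<notin> h ` ball p r;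
      norm a \<le> S; norm b \<le> S; \<delta> \<le> dist a b; x \<in> cball p (r / 4); y \<in> cball p (r / 4)\<rbrakk>
      \<Longrightarrow> dist (riemann_embed (h x)) (riemann_embed (h y)) \<le> L * dist x y"
proof -
  obtain C where C: "C \<ge> 1" and Schottky:
    "\<And>h p r z. \<lbrakk>0 < r; h holomorphic_on ball p r; \<And>x. x \<in> ball p r \<Longrightarrow> h x \<noteq> 0 \<and> h x \<noteq> 1;
        norm (h p) \<le> 2; z \<in> cball p (r / 2)\<rbrakk> \<Longrightarrow> norm (h z) \<le> C"
    by (rule Schottky_ball) blast
  define L1 where "L1 = 2 * (2 * S) * (4 * C / r)"
  define L2 where "L2 = 2 * (2 * S) * (S + 1)\<^sup>2 / \<delta>\<^sup>2 * (4 * C / r)"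
  show thesis
  proof (rule that[of "max L1 L2"])
    fix h :: "complex \<Rightarrow> complex" and p a b x y
    assume hol: "h holomorphic_on ball p r" and a: "a \<notin> h ` ball p r" and b: "b \<notin> h ` ball p r"
      and aS: "norm a \<le> S" and bS: "norm b \<le> S" and ab: "\<delta> \<le> dist a b"
      and x: "x \<in> cball p (r / 4)" and y: "y \<in> cball p (r / 4)"
    have xy: "x \<in> ball p r" "y \<in> ball p r" using x y r by auto
    define c where "c = b - a"
    have c: "\<delta> \<le> norm c" "norm c \<le> 2 * S"
      using ab aS bS norm_triangle_ineq4[of b a] by (auto simp: c_def dist_norm norm_minus_commute)
    have c0: "c \<noteq> 0" using c \<delta> by auto
    define H where "H = (\<lambda>z. (h z - a) / c)"
    have hH: "h z = a + c * H z" for z using c0 by (simp add: H_def)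
    have H01: "H z \<noteq> 0 \<and> H z \<noteq> 1" if "z \<in> ball p r" for z
      using hH[of z] a b that by (force simp: c_def)
    have holH: "H holomorphic_on ball p r"
      unfolding H_def using c0 by (intro holomorphic_intros hol) auto
    show "dist (riemann_embed (h x)) (riemann_embed (h y)) \<le> max L1 L2 * dist x y"
    proof (cases "norm (H p) \<le> 1")
      case True
      then have bd: "norm (H z) \<le> C" if "z \<in> cball p (r / 2)" for z
        using Schottky[OF r holH H01 _ that] by simp
      have "dist (riemann_embed (h x)) (riemann_embed (h y)) \<le> 2 * norm (h x - h y)"
        by (rule dist_riemann_embed_le)
      also have "\<dots> = 2 * norm c * norm (H x - H y)"
        by (simp add: hH norm_mult[symmetric] algebra_simps)
      also have "\<dots> \<le> 2 * (2 * S) * (4 * C / r * norm (x - y))"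
        using holomorphic_bounded_imp_Lipschitz[OF holH r bd x y] c S by (intro mult_mono) auto
      also have "\<dots> = L1 * dist x y" by (simp add: L1_def dist_norm)
      also have "\<dots> \<le> max L1 L2 * dist x y" by (intro mult_right_mono) auto
      finally show ?thesis .
    next
      case False
      define E where "E = (\<lambda>z. 1 / H z)"
      have E01: "E z \<noteq> 0 \<and> E z \<noteq> 1" if "z \<in> ball p r" for z
        using H01[OF that] by (simp add: E_def)
      have holE: "E holomorphic_on ball p r"
        unfolding E_def using H01 by (intro holomorphic_intros holH) auto
      have "norm (E p) \<le> 2" using False by (simp add: E_def norm_divide divide_le_eq)
      then have bd: "norm (E z) \<le> C" if "z \<in> cball p (r / 2)" for z
        using Schottky[OF r holE E01 _ that] by simp
      have hE: "h z = a + c / E z" for z by (simp add: hH E_def)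
      have "dist (riemann_embed (h x)) (riemann_embed (h y))
          \<le> 2 * norm c * (S + 1)\<^sup>2 / \<delta>\<^sup>2 * norm (E x - E y)"
        unfolding hE using E01 xy
        by (intro dist_riemann_embed_Mobius_le aS c(1) \<delta>) auto
      also have "\<dots> \<le> 2 * (2 * S) * (S + 1)\<^sup>2 / \<delta>\<^sup>2 * (4 * C / r * norm (x - y))"
        using holomorphic_bounded_imp_Lipschitz[OF holE r bd x y] c S
        by (intro mult_mono divide_right_mono) auto
      also have "\<dots> = L2 * dist x y" by (simp add: L2_def dist_norm)
      also have "\<dots> \<le> max L1 L2 * dist x y" by (intro mult_right_mono) auto
      finally show ?thesis .
    qed
  qed
qed

text \<open>The sphere is compact, so a common Lipschitz bound suffices for the theorem of Arzela and
  Ascoli; it yields uniform convergence on the whole closed disc.\<close>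

lemma spherical_Lipschitz_imp_normal:
  assumes \<rho>: "\<rho> > 0"
    and Lip: "\<And>h x y. \<lbrakk>h \<in> F; x \<in> cball p \<rho>; y \<in> cball p \<rho>\<rbrakk>
      \<Longrightarrow> dist (riemann_embed (h x)) (riemann_embed (h y)) \<le> L * dist x y"
  shows "normal_family_on F (ball p \<rho>)"
  unfolding normal_family_on_def
proof (intro allI impI)
  fix h :: "nat \<Rightarrow> complex \<Rightarrow> complex" assume h: "range h \<subseteq> F"
  define L' where "L' = max L 1"
  have Lip': "norm (riemann_embed (h n x) - riemann_embed (h n y)) \<le> L' * norm (x - y)"
    if "x \<in> cball p \<rho>" "y \<in> cball p \<rho>" for n x y
  proof -
    have "dist (riemann_embed (h n x)) (riemann_embed (h n y)) \<le> L * dist x y"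
      using h that by (intro Lip) auto
    also have "\<dots> \<le> L' * dist x y" by (intro mult_right_mono) (auto simp: L'_def)
    finally show ?thesis by (simp add: dist_norm)
  qed
  obtain g k where "strict_mono (k :: nat \<Rightarrow> nat)" and
    g: "\<And>e. 0 < e \<Longrightarrow> \<exists>N. \<forall>n x. n \<ge> N \<and> x \<in> cball p \<rho> \<longrightarrow> norm (riemann_embed (h (k n) x) - g x) < e"
  proof (rule Arzela_Ascoli[of "cball p \<rho>" "\<lambda>n x. riemann_embed (h n x)" 1])
    fix x and e :: real assume x: "x \<in> cball p \<rho>" and e: "0 < e"
    have "norm (riemann_embed (h n x) - riemann_embed (h n y)) < e"
      if "y \<in> cball p \<rho>" "norm (x - y) < e / L'" for n y
    proof -
      have "L' * norm (x - y) < e" using that by (simp add: L'_def field_simps)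
      then show ?thesis using Lip'[OF x that(1), of n] by simp
    qed
    then show "\<exists>d>0. \<forall>n y. y \<in> cball p \<rho> \<and> norm (x - y) < d \<longrightarrow>
        norm (riemann_embed (h n x) - riemann_embed (h n y)) < e"
      using e by (intro exI[of _ "e / L'"]) (auto simp: L'_def)
  qed (auto simp: norm_riemann_embed)
  moreover have "uniform_limit K (\<lambda>n z. riemann_embed (h (k n) z)) g sequentially"
    if "K \<subseteq> ball p \<rho>" for K
  proof (rule uniform_limitI)
    fix e :: real assume "0 < e"
    then obtain N where N: "\<And>n x. \<lbrakk>n \<ge> N; x \<in> cball p \<rho>\<rbrakk> \<Longrightarrow> norm (riemann_embed (h (k n) x) - g x) < e"
      using g by meson
    show "\<forall>\<^sub>F n in sequentially. \<forall>x\<in>K. dist (riemann_embed (h (k n) x)) (g x) < e"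
      using eventually_ge_at_top[of N]
    proof eventually_elim
      case (elim n)
      then show ?case using N that by (auto simp: dist_norm)
    qed
  qed
  ultimately show "\<exists>r g. strict_mono r \<and> (\<forall>K. compact K \<and> K \<subseteq> ball p \<rho> \<longrightarrow>
      uniform_limit K (\<lambda>k z. riemann_embed (h (r k) z)) g sequentially)"
    by blast
qed

section \<open>Covering by images of neighbourhoods of Julia points\<close>

text \<open>If the conclusion fails, every \<open>f\<^sup>k\<close> with \<open>k \<ge> N\<close> omits a point of \<open>A\<close> and a point of \<open>B\<close>. These
  omitted values are bounded and uniformly separated, so these iterates are uniformly Lipschitz in
  the chordal metric near \<open>p\<close>. Each of the finitely many others is Lipschitz there as well, so the
  whole family is normal near \<open>p\<close>.\<close>

theorem julia_set_covering:
  assumes f: "f holomorphic_on UNIV" and p: "p \<in> julia_set f" and r: "r > 0"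
    and A: "compact A" and B: "compact B" and AB: "A \<inter> B = {}"
  obtains k where "k \<ge> N" "A \<subseteq> (f ^^ k) ` ball p r \<or> B \<subseteq> (f ^^ k) ` ball p r"
proof (rule ccontr)
  assume "\<not> thesis"
  then have "\<forall>k. \<exists>a b. k \<ge> N \<longrightarrow> a \<in> A \<and> b \<in> B \<and> a \<notin> (f ^^ k) ` ball p r \<and> b \<notin> (f ^^ k) ` ball p r"
    using that by blast
  then obtain a b where ab: "\<And>k. k \<ge> N \<Longrightarrow> a k \<in> A \<and> b k \<in> B
      \<and> a k \<notin> (f ^^ k) ` ball p r \<and> b k \<notin> (f ^^ k) ` ball p r"
    by metis
  obtain S where S: "S > 0" "\<And>x. x \<in> A \<union> B \<Longrightarrow> norm x \<le> S"
    using compact_imp_bounded[OF compact_Un[OF A B]] bounded_pos by metis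
  have "\<exists>\<delta>>0. \<forall>x\<in>A. \<forall>y\<in>B. \<delta> \<le> dist x y"
    by (rule separate_compact_closed[OF A compact_imp_closed[OF B] AB])
  then obtain \<delta> where \<delta>: "\<delta> > 0" "\<And>x y. x \<in> A \<Longrightarrow> y \<in> B \<Longrightarrow> \<delta> \<le> dist x y"
    by blast
  obtain L where L: "\<And>h p a b x y. \<lbrakk>h holomorphic_on ball p r; a \<notin> h ` ball p r; b \<notin> h ` ball p r;
      norm a \<le> S; norm b \<le> S; \<delta> \<le> dist a b; x \<in> cball p (r / 4); y \<in> cball p (r / 4)\<rbrakk>
      \<Longrightarrow> dist (riemann_embed (h x)) (riemann_embed (h y)) \<le> L * dist x y"
    using omitting_two_values_imp_spherical_Lipschitz[OF r _ \<delta>(1), of S] S(1)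
    by (metis less_eq_real_def)
  define D where "D = (\<lambda>n x y. dist (riemann_embed ((f ^^ n) x)) (riemann_embed ((f ^^ n) y)))"
  have large: "D n x y \<le> L * dist x y"
    if "n \<ge> N" "x \<in> cball p (r / 4)" "y \<in> cball p (r / 4)" for n x y
    unfolding D_def
    by (rule L[of "f ^^ n" p "a n" "b n"])
       (use that ab[OF that(1)] S \<delta> holomorphic_on_subset[OF holomorphic_on_funpow[OF f]] in auto)
  have "\<exists>M. \<forall>x\<in>cball p (r / 4). \<forall>y\<in>cball p (r / 4). D n x y \<le> M * dist x y" for n
  proof -
    have "compact ((f ^^ n) ` cball p (r / 2))"
      using holomorphic_on_imp_continuous_on[OF holomorphic_on_funpow[OF f]]
      by (intro compact_continuous_image) (auto intro: continuous_on_subset)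
    then obtain M where M: "\<And>x. x \<in> cball p (r / 2) \<Longrightarrow> norm ((f ^^ n) x) \<le> M"
      using compact_imp_bounded bounded_pos by (metis imageI)
    have hol: "(f ^^ n) holomorphic_on ball p r"
      using holomorphic_on_funpow[OF f] by (rule holomorphic_on_subset) auto
    have "D n x y \<le> (2 * (4 * M / r)) * dist x y"
      if "x \<in> cball p (r / 4)" "y \<in> cball p (r / 4)" for x y
      using dist_riemann_embed_le[of "(f ^^ n) x" "(f ^^ n) y"]
        holomorphic_bounded_imp_Lipschitz[OF hol r M that]
      unfolding D_def dist_norm by linarith
    then show ?thesis by blast
  qed
  then obtain M where M: "\<And>n x y. x \<in> cball p (r / 4) \<Longrightarrow> y \<in> cball p (r / 4) \<Longrightarrow> D n x y \<le> M n * dist x y"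
    by metis
  define L' where "L' = Max (insert L (M ` {..<N}))"
  have "D n x y \<le> L' * dist x y" if xy: "x \<in> cball p (r / 4)" "y \<in> cball p (r / 4)" for n x y
  proof (cases "n \<ge> N")
    case True
    have "D n x y \<le> L * dist x y" by (rule large[OF True xy])
    also have "\<dots> \<le> L' * dist x y" unfolding L'_def by (intro mult_right_mono Max_ge) auto
    finally show ?thesis .
  next
    case False
    have "D n x y \<le> M n * dist x y" by (rule M[OF xy])
    also have "\<dots> \<le> L' * dist x y" unfolding L'_def using False by (intro mult_right_mono Max_ge) auto
    finally show ?thesis .
  qed
  then have "normal_family_on (range (\<lambda>n. f ^^ n)) (ball p (r / 4))"
    using r by (intro spherical_Lipschitz_imp_normal[where L = L']) (auto simp: D_def)
  moreover have "p \<in> ball p (r / 4)" using r by simp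
  ultimately show False using p unfolding julia_set_def by blast
qed

section \<open>Growth of the maximum modulus\<close>

text \<open>A weak form of Bohr's theorem. With \<open>s\<close> a small multiple of \<open>M(\<rho>, g)\<close>, suppose that the image of
  the disc of radius \<open>2\<rho>\<close> misses a point of each of the circles of radius \<open>s\<close> and \<open>2s\<close>. By
  Schottky's theorem \<open>|g|\<close> is then bounded by a fixed multiple of \<open>s\<close> on the disc of radius \<open>\<rho>\<close>,
  which contradicts the choice of \<open>s\<close>.\<close>

lemma image_contains_circle:
  obtains C :: real where "C \<ge> 1"
    "\<And>g \<rho>. \<lbrakk>g holomorphic_on UNIV; 0 < \<rho>; 0 < max_modulus \<rho> g;
        C * norm (g 0) \<le> max_modulus \<rho> g\<rbrakk>
      \<Longrightarrow> \<exists>t \<ge> max_modulus \<rho> g / C. sphere 0 t \<subseteq> g ` ball 0 (2 * \<rho>)"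
proof -
  obtain C0 where C0: "C0 \<ge> 1" and Schottky:
    "\<And>h p r z. \<lbrakk>0 < r; h holomorphic_on ball p r; \<And>x. x \<in> ball p r \<Longrightarrow> h x \<noteq> 0 \<and> h x \<noteq> 1;
        norm (h p) \<le> 2; z \<in> cball p (r / 2)\<rbrakk> \<Longrightarrow> norm (h z) \<le> C0"
    by (rule Schottky_ball) blast
  \<comment> \<open>Omitted values on both circles would give \<open>M(\<rho>, g) \<le> (1 + 3 * C0) * s\<close>, with \<open>s = M(\<rho>, g) / C\<close>.\<close>
  define C where "C = 2 + 3 * C0"
  show thesis
  proof (rule that[of C])
    show "C \<ge> 1" using C0 by (simp add: C_def)
    fix g \<rho> assume g: "g holomorphic_on UNIV" and \<rho>: "(0::real) < \<rho>"
      and M: "0 < max_modulus \<rho> g" "C * norm (g 0) \<le> max_modulus \<rho> g"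
    define s where "s = max_modulus \<rho> g / C"
    have C: "C > 0" using C0 by (simp add: C_def)
    have s: "s > 0" "norm (g 0) \<le> s" "max_modulus \<rho> g = C * s"
      using M C by (auto simp: s_def field_simps)
    have "sphere 0 s \<subseteq> g ` ball 0 (2 * \<rho>) \<or> sphere 0 (2 * s) \<subseteq> g ` ball 0 (2 * \<rho>)"
    proof (rule ccontr)
      assume "\<not> ?thesis"
      then obtain a b where a: "norm a = s" "a \<notin> g ` ball 0 (2 * \<rho>)"
        and b: "norm b = 2 * s" "b \<notin> g ` ball 0 (2 * \<rho>)"
        by (metis mem_sphere_0 subsetI)
      define c where "c = b - a"
      have c: "s \<le> norm c" "norm c \<le> 3 * s"
        using norm_triangle_ineq2[of b a] norm_triangle_ineq4[of b a] a b by (auto simp: c_def)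
      have c0: "c \<noteq> 0" using c s by auto
      define H where "H = (\<lambda>z. (g z - a) / c)"
      have gH: "g z = a + c * H z" for z using c0 by (simp add: H_def)
      obtain z where z: "norm z = \<rho>" "norm (g z) = max_modulus \<rho> g"
        using max_modulus_attained[OF holomorphic_on_imp_continuous_on[OF g], of \<rho>] \<rho> by auto
      have "norm (H z) \<le> C0"
      proof (rule Schottky[of "2 * \<rho>" H 0])
        show "H holomorphic_on ball 0 (2 * \<rho>)"
          unfolding H_def using c0 by (intro holomorphic_intros holomorphic_on_subset[OF g]) auto
        show "H x \<noteq> 0 \<and> H x \<noteq> 1" if "x \<in> ball 0 (2 * \<rho>)" for x
          using gH[of x] a b that by (force simp: c_def)
        have "norm (g 0 - a) \<le> 2 * s" using norm_triangle_ineq4[of "g 0" a] a s by simp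
        also have "\<dots> \<le> 2 * norm c" using c by simp
        finally show "norm (H 0) \<le> 2"
          using c0 by (simp add: H_def norm_divide divide_le_eq)
      qed (use \<rho> z in auto)
      then have "norm (c * H z) \<le> 3 * s * C0"
        unfolding norm_mult using c s by (intro mult_mono) auto
      then have "norm (g z) \<le> s + 3 * s * C0"
        using norm_triangle_ineq[of a "c * H z"] a gH[of z] by simp
      then have "C * s \<le> (1 + 3 * C0) * s" using z s by (simp add: algebra_simps)
      then show False using s(1) by (simp add: C_def)
    qed
    then show "\<exists>t \<ge> max_modulus \<rho> g / C. sphere 0 t \<subseteq> g ` ball 0 (2 * \<rho>)"
    proof
      assume "sphere 0 s \<subseteq> g ` ball 0 (2 * \<rho>)"
      then show ?thesis by (intro exI[of _ s]) (auto simp: s_def)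
    next
      assume "sphere 0 (2 * s) \<subseteq> g ` ball 0 (2 * \<rho>)"
      moreover have "s \<le> 2 * s" using s by simp
      ultimately show ?thesis by (intro exI[of _ "2 * s"]) (auto simp: s_def)
    qed
  qed
qed

lemma entire_quadratic_factor:
  assumes f: "f holomorphic_on UNIV"
  obtains a0 a1 h where "h holomorphic_on UNIV" "\<And>z. f z = a0 + a1 * z + z\<^sup>2 * h z"
proof -
  define f1 where "f1 = (\<lambda>z. if z = 0 then deriv f 0 else (f z - f 0) / (z - 0))"
  define f2 where "f2 = (\<lambda>z. if z = 0 then deriv f1 0 else (f1 z - f1 0) / (z - 0))"
  have 1: "f1 holomorphic_on UNIV"
    unfolding f1_def by (rule pole_lemma[OF f]) auto
  have 2: "f2 holomorphic_on UNIV"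
    unfolding f2_def by (rule pole_lemma[OF 1]) auto
  have "f z = f 0 + f1 0 * z + z\<^sup>2 * f2 z" for z
  proof -
    have "f z = f 0 + z * f1 z" by (simp add: f1_def)
    moreover have "f1 z = f1 0 + z * f2 z" by (simp add: f2_def)
    ultimately show ?thesis by (simp add: power2_eq_square algebra_simps)
  qed
  with 2 show thesis by (rule that)
qed

text \<open>Write \<open>f(z) = a\<^sub>0 + a\<^sub>1 z + z\<^sup>2 h(z)\<close> with \<open>h \<noteq> 0\<close>. For large \<open>r\<close> the last term dominates, and
  its maximum modulus \<open>N r = r\<^sup>2 M(r, h)\<close> satisfies \<open>N (\<kappa> r) \<ge> \<kappa>\<^sup>2 N r\<close> because \<open>M(r, h)\<close> is
  increasing. The factor 3 is the price for \<open>N/2 \<le> M(r, f) \<le> 3N/2\<close>.\<close>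

lemma max_modulus_superlinear:
  assumes f: "f holomorphic_on UNIV" and nonaff: "\<not> (\<exists>a b. \<forall>z. f z = a + b * z)"
  obtains c r0 where "c > 0" "r0 \<ge> 1" "\<And>r. r \<ge> r0 \<Longrightarrow> c * r\<^sup>2 \<le> max_modulus r f"
    "\<And>r \<kappa>. \<lbrakk>r \<ge> r0; \<kappa> \<ge> 1\<rbrakk> \<Longrightarrow> \<kappa>\<^sup>2 / 3 * max_modulus r f \<le> max_modulus (\<kappa> * r) f"
proof -
  obtain a0 a1 h where h: "h holomorphic_on UNIV" and fh: "\<And>z. f z = a0 + a1 * z + z\<^sup>2 * h z"
    using entire_quadratic_factor[OF f] by metis
  obtain z1 where z1: "h z1 \<noteq> 0" using nonaff fh by fastforce
  define c where "c = norm (h z1)"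
  have c: "c > 0" using z1 by (simp add: c_def)
  define N where "N = (\<lambda>r. r\<^sup>2 * max_modulus r h)"
  \<comment> \<open>The third entry makes \<open>norm a0 + norm a1 \<le> c * r / 2\<close> for \<open>r \<ge> r0\<close>.\<close>
  define r0 where "r0 = Max {1, norm z1, 2 * (norm a0 + norm a1) / c}"
  have r0: "1 \<le> r0" "norm z1 \<le> r0" "2 * (norm a0 + norm a1) / c \<le> r0"
    unfolding r0_def by auto
  have Nc: "c * r\<^sup>2 \<le> N r" if "r \<ge> r0" for r
  proof -
    have "c \<le> max_modulus r h"
      unfolding c_def by (rule norm_le_max_modulus[OF h]) (use r0 that in linarith)
    then show ?thesis unfolding N_def by (subst mult.commute) (rule mult_left_mono, auto)
  qed
  have affine_small: "norm (a0 + a1 * z) \<le> N r / 2" if "r \<ge> r0" "norm z = r" for r z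
  proof -
    have r: "1 \<le> r" using r0 that by linarith
    have "norm (a0 + a1 * z) \<le> norm a0 * 1 + norm a1 * r"
      using norm_triangle_ineq[of a0 "a1 * z"] that by (simp add: norm_mult)
    also have "\<dots> \<le> norm a0 * r + norm a1 * r" using r by (intro add_mono mult_left_mono) auto
    also have "\<dots> = (norm a0 + norm a1) * r" by (simp add: algebra_simps)
    also have "\<dots> \<le> (c * r / 2) * r"
    proof (rule mult_right_mono)
      have "2 * (norm a0 + norm a1) / c \<le> r" using r0 that by linarith
      then show "norm a0 + norm a1 \<le> c * r / 2" using c by (simp add: field_simps)
    qed (use r in simp)
    also have "\<dots> \<le> N r / 2" using Nc[OF that(1)] by (simp add: power2_eq_square)
    finally show ?thesis .
  qed
  have lower: "N r / 2 \<le> max_modulus r f" if r: "r \<ge> r0" for r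
  proof -
    obtain z where z: "norm z = r" "norm (h z) = max_modulus r h"
      using max_modulus_attained[OF holomorphic_on_imp_continuous_on[OF h], of r] r r0 by auto
    have "N r = norm (z\<^sup>2 * h z)" using z by (simp add: N_def norm_mult norm_power)
    also have "z\<^sup>2 * h z = f z - (a0 + a1 * z)" using fh[of z] by simp
    also have "norm \<dots> \<le> norm (f z) + norm (a0 + a1 * z)" by (rule norm_triangle_ineq4)
    also have "\<dots> \<le> max_modulus r f + N r / 2"
      using affine_small[OF r z(1)] norm_le_max_modulus[OF f, of z r] z by simp
    finally show ?thesis by simp
  qed
  have upper: "max_modulus r f \<le> 3 / 2 * N r" if r: "r \<ge> r0" for r
  proof -
    obtain z where z: "norm z = r" "norm (f z) = max_modulus r f"
      using max_modulus_attained[OF holomorphic_on_imp_continuous_on[OF f], of r] r r0 by auto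
    have "norm (f z) \<le> norm (a0 + a1 * z) + norm (z\<^sup>2 * h z)"
      unfolding fh[of z] by (rule norm_triangle_ineq)
    also have "norm (z\<^sup>2 * h z) \<le> N r"
      using norm_le_max_modulus[OF h, of z r] z(1)
      by (simp add: N_def norm_mult norm_power mult_left_mono)
    finally show ?thesis using affine_small[OF r z(1)] z by simp
  qed
  show thesis
  proof (rule that[of "c / 2" r0])
    show "c / 2 * r\<^sup>2 \<le> max_modulus r f" if "r \<ge> r0" for r
      using Nc[OF that] lower[OF that] by simp
    show "\<kappa>\<^sup>2 / 3 * max_modulus r f \<le> max_modulus (\<kappa> * r) f" if "r \<ge> r0" "\<kappa> \<ge> 1" for r \<kappa>
    proof -
      have r: "r \<ge> 0" "r \<le> \<kappa> * r"
        using that r0 mult_right_mono[of 1 \<kappa> r] by auto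
      have "\<kappa>\<^sup>2 / 3 * max_modulus r f \<le> \<kappa>\<^sup>2 / 3 * (3 / 2 * N r)"
        by (rule mult_left_mono[OF upper[OF that(1)]]) simp
      also have "\<dots> = (\<kappa> * r)\<^sup>2 * max_modulus r h / 2" by (simp add: N_def power_mult_distrib)
      also have "\<dots> \<le> (\<kappa> * r)\<^sup>2 * max_modulus (\<kappa> * r) h / 2"
        by (intro divide_right_mono mult_left_mono max_modulus_mono[OF h] r) auto
      also have "\<dots> \<le> max_modulus (\<kappa> * r) f"
        using lower[of "\<kappa> * r"] that r by (simp add: N_def)
      finally show ?thesis .
    qed
  qed (use c r0 in auto)
qed

text \<open>From \<open>r1 \<ge> exp 1\<close> on, logarithms are at least 1, so that additive constants can be absorbed
  into multiplicative ones.\<close>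

lemma max_modulus_log_growth:
  assumes f: "f holomorphic_on UNIV" and nonaff: "\<not> (\<exists>a b. \<forall>z. f z = a + b * z)"
  obtains r1 where "r1 \<ge> exp 1" "\<And>r. r \<ge> r1 \<Longrightarrow> r \<le> max_modulus r f"
    "\<And>r. r \<ge> r1 \<Longrightarrow> 3 / 2 * ln r \<le> ln (max_modulus r f)"
proof -
  obtain c r0 where c: "c > 0" "r0 \<ge> 1" "\<And>r. r \<ge> r0 \<Longrightarrow> c * r\<^sup>2 \<le> max_modulus r f"
    using max_modulus_superlinear[OF f nonaff] by metis
  define r1 where "r1 = Max {r0, exp 1, exp (- 2 * ln c)}"
  have r1: "r0 \<le> r1" "exp 1 \<le> r1" "exp (- 2 * ln c) \<le> r1" unfolding r1_def by auto
  have *: "3 / 2 * ln r \<le> ln (max_modulus r f) \<and> r \<le> max_modulus r f" if "r \<ge> r1" for r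
  proof -
    have r: "r > 0" "r \<ge> r0" "r \<ge> 1" using that r1 c by auto
    have M: "c * r\<^sup>2 \<le> max_modulus r f" by (rule c(3)[OF r(2)])
    have M0: "0 < max_modulus r f" using M mult_pos_pos[OF c(1), of "r\<^sup>2"] r by simp
    have "- 2 * ln c \<le> ln r" using r1 that r by (simp add: ln_ge_iff)
    then have "3 / 2 * ln r \<le> ln c + 2 * ln r" by linarith
    also have "\<dots> = ln (c * r\<^sup>2)" using c r by (simp add: ln_mult ln_realpow)
    also have "\<dots> \<le> ln (max_modulus r f)" using M M0 c r by (subst ln_le_cancel_iff) auto
    finally have A: "3 / 2 * ln r \<le> ln (max_modulus r f)" .
    have "0 \<le> ln r" using r by simp
    with A have "ln r \<le> ln (max_modulus r f)" by linarith
    then show ?thesis using A M0 r by simp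
  qed
  with r1 that show thesis by blast
qed

lemma max_modulus_iter_log_growth:
  assumes r1: "r1 \<ge> exp 1" "\<And>r. r \<ge> r1 \<Longrightarrow> r \<le> max_modulus r f"
    "\<And>r. r \<ge> r1 \<Longrightarrow> 3 / 2 * ln r \<le> ln (max_modulus r f)"
    and R: "R \<ge> r1"
  shows "r1 \<le> max_modulus_iter j R f"
    and "(3 / 2) ^ q * ln (max_modulus_iter j R f) \<le> ln (max_modulus_iter (j + q) R f)"
proof -
  show ge: "r1 \<le> max_modulus_iter j R f" for j
    by (induction j) (use R r1(2) in \<open>auto simp: max_modulus_iter_Suc_outer intro: order_trans\<close>)
  show "(3 / 2) ^ q * ln (max_modulus_iter j R f) \<le> ln (max_modulus_iter (j + q) R f)"
  proof (induction q)
    case (Suc q)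
    have "(3 / 2) ^ Suc q * ln (max_modulus_iter j R f)
        \<le> 3 / 2 * ln (max_modulus_iter (j + q) R f)"
      using mult_left_mono[OF Suc, of "3 / 2"] by (simp add: mult_ac)
    also have "\<dots> \<le> ln (max_modulus_iter (j + Suc q) R f)"
      using r1(3)[OF ge[of "j + q"]] by (simp add: max_modulus_iter_Suc_outer)
    finally show ?case .
  qed simp
qed

text \<open>By induction on \<open>j\<close>: the image under \<open>f\<close> of the disc of radius \<open>\<beta> r\<close> contains a circle of
  radius at least \<open>M(\<beta> r / 2, f) / C\<close>, and superlinearity makes this at least \<open>\<beta> M(r, f)\<close> once
  \<open>\<beta>\<close> is large. Splitting \<open>f\<^sup>j\<^sup>+\<^sup>1\<close> as \<open>f\<^sup>j \<circ> f\<close>, with \<open>f\<close> applied first, lets the same factor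
  \<open>\<beta>\<close> serve at every step.\<close>

lemma max_modulus_funpow_ge_iter:
  assumes f: "f holomorphic_on UNIV" and nonaff: "\<not> (\<exists>a b. \<forall>z. f z = a + b * z)"
  obtains \<beta> r2 where "\<beta> \<ge> 1"
    "\<And>r j. r \<ge> r2 \<Longrightarrow> max_modulus_iter j r f \<le> max_modulus (\<beta> * r) (f ^^ j)"
proof -
  obtain C where C: "C \<ge> 1" and circle:
    "\<And>g \<rho>. \<lbrakk>g holomorphic_on UNIV; 0 < \<rho>; 0 < max_modulus \<rho> g;
        C * norm (g 0) \<le> max_modulus \<rho> g\<rbrakk>
      \<Longrightarrow> \<exists>t \<ge> max_modulus \<rho> g / C. sphere 0 t \<subseteq> g ` ball 0 (2 * \<rho>)"
    by (rule image_contains_circle) blast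
  obtain c r0 where c: "c > 0" "r0 \<ge> 1" "\<And>r. r \<ge> r0 \<Longrightarrow> c * r\<^sup>2 \<le> max_modulus r f"
    and super: "\<And>r \<kappa>. \<lbrakk>r \<ge> r0; \<kappa> \<ge> 1\<rbrakk> \<Longrightarrow> \<kappa>\<^sup>2 / 3 * max_modulus r f \<le> max_modulus (\<kappa> * r) f"
    by (rule max_modulus_superlinear[OF f nonaff]) blast
  obtain r1 where r1: "r1 \<ge> exp 1" "\<And>r. r \<ge> r1 \<Longrightarrow> r \<le> max_modulus r f"
    by (rule max_modulus_log_growth[OF f nonaff]) blast
  \<comment> \<open>chosen so that \<open>(\<beta> / 2)\<^sup>2 / (3 C) = \<beta>\<close>\<close>
  define \<beta> where "\<beta> = 12 * C"
  have \<beta>: "\<beta> \<ge> 12" using C by (simp add: \<beta>_def)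
  define r2 where "r2 = Max {r0, r1, C * norm (f 0)}"
  have r2: "r0 \<le> r2" "r1 \<le> r2" "C * norm (f 0) \<le> r2" unfolding r2_def by auto
  have step: "\<exists>t \<ge> \<beta> * max_modulus r f. sphere 0 t \<subseteq> f ` ball 0 (\<beta> * r)" if r: "r \<ge> r2" for r
  proof -
    have r0': "r \<ge> 1" "r \<ge> r0" using r r2 c by auto
    have rM: "r \<le> max_modulus r f" using r1 r r2 by auto
    define \<rho> where "\<rho> = \<beta> / 2 * r"
    have \<rho>: "r \<le> \<rho>" unfolding \<rho>_def using \<beta> r0' mult_right_mono[of 1 "\<beta> / 2" r] by simp
    have "max_modulus r f \<le> max_modulus \<rho> f"
      by (rule max_modulus_mono[OF f]) (use \<rho> r0' in auto)
    then have ge: "r \<le> max_modulus \<rho> f" using rM by simp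
    have "\<beta> * max_modulus r f = (\<beta> / 2)\<^sup>2 / 3 * max_modulus r f / C"
      using C by (simp add: \<beta>_def power2_eq_square)
    also have "\<dots> \<le> max_modulus \<rho> f / C"
      unfolding \<rho>_def using C \<beta> by (intro divide_right_mono super r0') auto
    finally have le: "\<beta> * max_modulus r f \<le> max_modulus \<rho> f / C" .
    have "\<exists>t \<ge> max_modulus \<rho> f / C. sphere 0 t \<subseteq> f ` ball 0 (2 * \<rho>)"
    proof (rule circle[OF f])
      show "0 < \<rho>" "0 < max_modulus \<rho> f" using \<rho> r0' ge by auto
      show "C * norm (f 0) \<le> max_modulus \<rho> f" using r2 r ge by linarith
    qed
    then show ?thesis using le by (auto simp: \<rho>_def intro: order_trans)
  qed
  have "max_modulus_iter j r f \<le> max_modulus (\<beta> * r) (f ^^ j)" if "r \<ge> r2" for r j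
    using that
  proof (induction j arbitrary: r)
    case 0
    have r: "r \<ge> 1" using 0 r2 c by auto
    have "norm ((f ^^ 0) (of_real r)) \<le> max_modulus r (f ^^ 0)"
      by (rule norm_le_max_modulus[OF holomorphic_on_funpow[OF f]]) (use r in simp)
    also have "\<dots> \<le> max_modulus (\<beta> * r) (f ^^ 0)"
      using r \<beta> mult_right_mono[of 1 \<beta> r] by (intro max_modulus_mono holomorphic_on_funpow[OF f]) auto
    finally show ?case using r by (simp add: id_def)
  next
    case (Suc j)
    have r: "r \<ge> 1" using Suc.prems r2 c by auto
    have rM: "r \<le> max_modulus r f" using r1 Suc.prems r2 by auto
    obtain t where t: "\<beta> * max_modulus r f \<le> t" "sphere 0 t \<subseteq> f ` ball 0 (\<beta> * r)"
      using step[OF Suc.prems] by blast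
    have t0: "0 \<le> \<beta> * max_modulus r f" using \<beta> r rM by simp
    have "max_modulus_iter (Suc j) r f \<le> max_modulus (\<beta> * max_modulus r f) (f ^^ j)"
      using Suc.IH[of "max_modulus r f"] Suc.prems rM by (simp add: max_modulus_iter_Suc)
    also have "\<dots> \<le> max_modulus t (f ^^ j)"
      by (rule max_modulus_mono[OF holomorphic_on_funpow[OF f] t0 t(1)])
    also have "\<dots> \<le> max_modulus (\<beta> * r) (f ^^ Suc j)"
    proof -
      obtain y where y: "norm y = t" "norm ((f ^^ j) y) = max_modulus t (f ^^ j)"
        using max_modulus_attained[OF holomorphic_on_imp_continuous_on[OF holomorphic_on_funpow[OF f]], of t j]
          t t0 by (metis order_trans)
      then obtain x where x: "x \<in> ball 0 (\<beta> * r)" "y = f x"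
        using t(2) by (metis imageE mem_sphere_0 subsetD)
      have "norm ((f ^^ Suc j) x) \<le> max_modulus (\<beta> * r) (f ^^ Suc j)"
        by (rule norm_le_max_modulus[OF holomorphic_on_funpow[OF f]]) (use x in simp)
      then show ?thesis using x y by (simp add: funpow_swap1)
    qed
    finally show ?case .
  qed
  moreover have "\<beta> \<ge> 1" using \<beta> by simp
  ultimately show thesis using that by blast
qed

section \<open>A lower bound for the spherical derivative\<close>

text \<open>Harnack's inequality for the positive harmonic function \<open>Re G\<close>: the Moebius transformation
  \<open>u \<mapsto> (u - G w) / (u + cnj (G w))\<close> maps the right half-plane to the unit disc and \<open>G w\<close> to 0, so
  that Schwarz's lemma applies. The sharp factor \<open>(1 - \<rho>) / (1 + \<rho>)\<close> is replaced by \<open>(1 - \<rho>) / 2\<close>.\<close>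

lemma Harnack_lower_bound:
  fixes G :: "complex \<Rightarrow> complex"
  assumes hol: "G holomorphic_on ball w d"
    and pos: "\<And>x. x \<in> ball w d \<Longrightarrow> 0 < Re (G x)"
    and x: "x \<in> ball w d"
  shows "Re (G w) * (1 - dist w x / d) / 2 \<le> Re (G x)"
proof -
  have d: "d > 0" using x by (metis ball_empty empty_iff not_le)
  have w: "Re (G w) > 0" using pos d by simp
  define H where "H = (\<lambda>y. (G (w + of_real d * y) - G w) / (G (w + of_real d * y) + cnj (G w)))"
  have inb: "w + of_real d * y \<in> ball w d" if "norm y < 1" for y
    using that d by (simp add: dist_norm norm_mult)
  have nz: "G y + cnj (G w) \<noteq> 0" if "y \<in> ball w d" for y
    using pos[OF that] w by (auto simp: complex_eq_iff)
  have holG: "(\<lambda>y. G (w + of_real d * y)) holomorphic_on ball 0 1"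
    by (rule holomorphic_on_compose_gen[OF _ hol, unfolded o_def])
       (use inb in \<open>auto intro!: holomorphic_intros\<close>)
  have "H holomorphic_on ball 0 1"
    unfolding H_def using nz inb by (intro holomorphic_intros holG) auto
  moreover have "H 0 = 0" by (simp add: H_def)
  moreover have "norm (H y) < 1" if "norm y < 1" for y
  proof -
    define u where "u = G (w + of_real d * y)"
    have u: "Re u > 0" unfolding u_def by (intro pos inb that)
    have "(norm (u - G w))\<^sup>2 < (norm (u + cnj (G w)))\<^sup>2"
      using mult_pos_pos[OF u w] unfolding cmod_power2 by (simp add: power2_eq_square algebra_simps)
    then have "norm (u - G w) < norm (u + cnj (G w))" by (rule power2_less_imp_less) simp
    then show ?thesis
      unfolding H_def u_def[symmetric] by (simp add: norm_divide divide_less_eq_1)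
  qed
  moreover define \<rho> where "\<rho> = dist w x / d"
  have \<rho>: "0 \<le> \<rho>" "\<rho> < 1" using x d by (auto simp: \<rho>_def)
  define y where "y = (x - w) / of_real d"
  have y: "norm y = \<rho>" using d by (simp add: y_def \<rho>_def dist_norm norm_divide norm_minus_commute)
  ultimately have "norm (H y) \<le> \<rho>" using Schwarz_Lemma(1)[of H y] \<rho> by simp
  moreover have "w + of_real d * y = x" using d by (simp add: y_def)
  ultimately have le: "norm (G x - G w) \<le> \<rho> * norm (G x + cnj (G w))"
    using nz[OF x] by (simp add: H_def norm_divide divide_le_eq)
  define a where "a = Re (G x)"
  define b where "b = Re (G w)"
  have ab: "a > 0" "b > 0" using w pos[OF x] by (auto simp: a_def b_def)
  \<comment> \<open>The common imaginary part cancels after squaring, as \<open>\<rho> < 1\<close>.\<close>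
  have "(norm (G x - G w))\<^sup>2 \<le> \<rho>\<^sup>2 * (norm (G x + cnj (G w)))\<^sup>2"
    using power_mono[OF le norm_ge_zero, of 2] by (simp add: power_mult_distrib)
  then have "(a - b)\<^sup>2 + (Im (G x) - Im (G w))\<^sup>2
      \<le> \<rho>\<^sup>2 * ((a + b)\<^sup>2 + (Im (G x) - Im (G w))\<^sup>2)"
    by (simp add: cmod_power2 a_def b_def)
  moreover have "\<rho>\<^sup>2 * (Im (G x) - Im (G w))\<^sup>2 \<le> 1 * (Im (G x) - Im (G w))\<^sup>2"
    using \<rho> by (intro mult_right_mono) (auto simp: power_le_one)
  ultimately have "(a - b)\<^sup>2 \<le> (\<rho> * (a + b))\<^sup>2"
    unfolding power_mult_distrib by (simp add: distrib_left)
  then have "b - a \<le> \<rho> * (a + b)"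
    by (smt (verit) \<rho> ab mult_nonneg_nonneg power2_le_imp_le power2_commute)
  then have "b * (1 - \<rho>) \<le> a * (1 + \<rho>)" by (simp add: algebra_simps)
  also have "\<dots> \<le> a * 2" using \<rho> ab by (intro mult_left_mono) auto
  finally show ?thesis by (simp add: a_def b_def \<rho>_def)
qed

text \<open>Let \<open>\<zeta>\<close> be a point nearest to \<open>w\<close> where \<open>|g| \<le> K\<close>; its distance \<open>d\<close> to \<open>w\<close> is at most \<open>2r\<close>, so
  the closed disc of radius \<open>d\<close> about \<open>w\<close> stays within \<open>3r\<close> of \<open>p\<close>. Harnack's inequality for
  \<open>ln (|g| / K)\<close> gives linear growth along the segment from \<open>\<zeta>\<close> to \<open>w\<close>, at a rate
  proportional to \<open>L = ln (|g w| / K)\<close>. Hence \<open>|g'(\<zeta>)| \<ge> K L / (2 d)\<close>.\<close>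

lemma spherical_deriv_lower_bound:
  assumes U: "cball p (3 * r) \<subseteq> U" and hol: "g holomorphic_on U" and Uo: "open U"
    and K: "K > 0"
    and z: "z \<in> cball p r" "norm (g z) \<le> K"
    and w: "w \<in> cball p r" "norm (g w) > K"
  obtains \<zeta> where "\<zeta> \<in> U"
    "ln (norm (g w) / K) \<le> 4 * r * (1 + K\<^sup>2) / K * spherical_deriv g \<zeta>"
proof -
  define S where "S = {x \<in> cball p (3 * r). norm (g x) \<le> K}"
  have contg: "continuous_on (cball p (3 * r)) g"
    using hol U by (meson holomorphic_on_imp_continuous_on holomorphic_on_subset)
  have r: "r \<ge> 0" using z(1) by (metis cball_empty empty_iff not_le)
  have zS: "z \<in> S" using z r by (auto simp: S_def)
  have "closed S" unfolding S_def
    using continuous_closed_preimage[OF contg closed_cball, of "cball 0 K"]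
    by (simp add: vimage_def Int_def)
  then obtain \<zeta> where \<zeta>: "\<zeta> \<in> S" "\<And>y. y \<in> S \<Longrightarrow> dist w \<zeta> \<le> dist w y"
    using distance_attains_inf zS by (metis empty_iff)
  define d where "d = dist w \<zeta>"
  have "w \<noteq> \<zeta>" using \<zeta>(1) w by (auto simp: S_def)
  then have d: "d > 0" by (simp add: d_def)
  have "d \<le> dist w z" using \<zeta>(2)[OF zS] by (simp add: d_def)
  also have "\<dots> \<le> 2 * r"
    using dist_triangle2[of w z p] z(1) w(1) by (simp add: dist_commute)
  finally have d2: "d \<le> 2 * r" .
  have sub: "cball w d \<subseteq> cball p (3 * r)"
  proof
    fix y assume "y \<in> cball w d"
    then show "y \<in> cball p (3 * r)"
      using dist_triangle[of p y w] w(1) d2 by auto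
  qed
  have big: "norm (g y) > K" if "y \<in> ball w d" for y
  proof (rule ccontr)
    assume "\<not> ?thesis"
    moreover have "y \<in> cball p (3 * r)"
      using sub that ball_subset_cball[of w d] by blast
    ultimately have "y \<in> S" by (simp add: S_def)
    then show False using \<zeta>(2) that by (force simp: d_def)
  qed
  have \<zeta>U: "\<zeta> \<in> U" using \<zeta>(1) U by (auto simp: S_def)
  have "(\<lambda>y. g y / of_real K) holomorphic_on ball w d"
    using U sub K ball_subset_cball[of w d]
    by (intro holomorphic_intros holomorphic_on_subset[OF hol]) (blast, simp)
  moreover have "g y / of_real K \<noteq> 0" if "y \<in> ball w d" for y
    using big[OF that] K by auto
  ultimately obtain G where G: "G holomorphic_on ball w d"
    "\<And>y. y \<in> ball w d \<Longrightarrow> g y / of_real K = exp (G y)"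
    by (rule contractible_imp_holomorphic_log[OF _ convex_imp_contractible[OF convex_ball]]) auto
  have ReG: "Re (G y) = ln (norm (g y) / K)" if "y \<in> ball w d" for y
  proof -
    have "norm (g y) / K = norm (exp (G y))"
      using G(2)[OF that, symmetric] K by (simp add: norm_divide)
    then show ?thesis by simp
  qed
  have pos: "Re (G y) > 0" if "y \<in> ball w d" for y
    unfolding ReG[OF that] using big[OF that] K by (intro ln_gt_zero) simp
  define L where "L = ln (norm (g w) / K)"
  have der: "(g has_field_derivative deriv g \<zeta>) (at \<zeta>)"
    using hol Uo \<zeta>U by (rule holomorphic_derivI)
  define \<gamma> where "\<gamma> = (\<lambda>t::real. \<zeta> + of_real t * (w - \<zeta>))"
  have "((\<lambda>z. g (\<zeta> + z * (w - \<zeta>))) has_field_derivative deriv g \<zeta> * (w - \<zeta>)) (at 0)"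
    by (rule DERIV_chain2[where f = g]) (use der in \<open>auto intro!: derivative_eq_intros\<close>)
  then have "((\<lambda>z. (g (\<zeta> + z * (w - \<zeta>)) - g \<zeta>) / z) \<longlongrightarrow> deriv g \<zeta> * (w - \<zeta>)) (at 0)"
    by (simp add: DERIV_def)
  moreover have "filterlim complex_of_real (at 0) (at_right 0)"
    unfolding filterlim_at
    by (auto simp: eventually_at_filter intro!: tendsto_eq_intros)
  ultimately have "((\<lambda>t. (g (\<gamma> t) - g \<zeta>) / of_real t) \<longlongrightarrow> deriv g \<zeta> * (w - \<zeta>)) (at_right 0)"
    unfolding \<gamma>_def by (rule filterlim_compose)
  then have lim: "((\<lambda>t. norm ((g (\<gamma> t) - g \<zeta>) / of_real t)) \<longlongrightarrow> norm ((w - \<zeta>) * deriv g \<zeta>)) (at_right 0)"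
    by (subst mult.commute) (rule tendsto_norm)
  have "eventually (\<lambda>t::real. K * L / 2 \<le> norm ((g (\<gamma> t) - g \<zeta>) / of_real t)) (at_right 0)"
  proof -
    have "eventually (\<lambda>t::real. t \<in> {0<..<1}) (at_right 0)"
      by (rule eventually_at_right_real) simp
    then show ?thesis
    proof eventually_elim
      case (elim t)
      define x where "x = \<gamma> t"
      have "x - w = of_real (t - 1) * (w - \<zeta>)"
        by (simp add: x_def \<gamma>_def algebra_simps)
      then have dx: "dist w x = (1 - t) * d"
        using elim by (metis abs_minus_commute abs_of_pos d_def diff_gt_0_iff_gt dist_commute
            dist_norm greaterThanLessThan_iff norm_mult norm_of_real)
      then have xb: "x \<in> ball w d" using d elim by simp
      have "L * t / 2 = Re (G w) * (1 - dist w x / d) / 2"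
        using dx d ReG[of w] by (simp add: L_def)
      also have "\<dots> \<le> Re (G x)" by (rule Harnack_lower_bound[OF G(1) pos xb])
      also have "\<dots> \<le> norm (g x) / K - 1"
        unfolding ReG[OF xb] using big[OF xb] K
        by (intro ln_le_minus_one divide_pos_pos) linarith+
      finally have "K * (L * t / 2) \<le> norm (g x) - K"
        using K by (simp add: field_simps)
      also have "\<dots> \<le> norm (g x) - norm (g \<zeta>)" using \<zeta>(1) by (simp add: S_def)
      also have "\<dots> \<le> norm (g x - g \<zeta>)" by (rule norm_triangle_ineq2)
      finally show ?case using elim by (simp add: x_def norm_divide field_simps)
    qed
  qed
  then have "K * L / 2 \<le> norm ((w - \<zeta>) * deriv g \<zeta>)"
    by (intro tendsto_lowerbound[OF lim]) auto
  also have "\<dots> = d * norm (deriv g \<zeta>)" by (simp add: norm_mult d_def dist_norm)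
  also have "\<dots> \<le> 2 * r * norm (deriv g \<zeta>)" using d2 by (intro mult_right_mono) auto
  also have "norm (deriv g \<zeta>) = (1 + (norm (g \<zeta>))\<^sup>2) * spherical_deriv g \<zeta>"
    by (simp add: spherical_deriv_def) (smt (verit) zero_le_power2)
  also have "\<dots> \<le> (1 + K\<^sup>2) * spherical_deriv g \<zeta>"
    using \<zeta>(1) by (intro mult_right_mono add_left_mono power_mono)
      (auto simp: S_def spherical_deriv_def)
  finally have "K * L / 2 \<le> 2 * r * ((1 + K\<^sup>2) * spherical_deriv g \<zeta>)"
    using r by (simp add: mult_left_mono)
  then have "L \<le> 4 * r * (1 + K\<^sup>2) / K * spherical_deriv g \<zeta>"
    using K by (simp add: field_simps)
  with \<zeta>U that show thesis by (simp add: L_def)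
qed

section \<open>Small and large values of the iterates near Julia points\<close>

text \<open>Pulling back along \<open>f\<^sup>j\<close> produces, for each \<open>n\<close>, a point of \<open>C\<close> which returns to \<open>C\<close> at all
  multiples of \<open>j\<close> up to \<open>n\<close>. The bound \<open>K\<close> only has to account for the fewer than \<open>j\<close> remaining
  steps.\<close>

lemma self_covering_imp_bounded_minima:
  fixes f :: "complex \<Rightarrow> complex"
  assumes f: "continuous_on UNIV f" and C: "compact C" "C \<noteq> {}"
    and j: "j \<ge> 1" and cov: "C \<subseteq> (f ^^ j) ` C"
  obtains K where "\<And>n. \<exists>z\<in>C. norm ((f ^^ n) z) \<le> K"
proof -
  have cont: "continuous_on C (f ^^ n)" for n
  proof (induction n)
    case (Suc n)
    have "continuous_on C (f \<circ> (f ^^ n))"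
      by (rule continuous_on_compose[OF Suc continuous_on_subset[OF f]]) simp
    then show ?case by simp
  qed (simp add: id_def)
  have "\<exists>B. \<forall>z\<in>C. norm ((f ^^ n) z) \<le> B" for n
    using compact_imp_bounded[OF compact_continuous_image[OF cont C(1)]]
    by (auto simp: bounded_iff)
  then obtain B where B: "\<And>n z. z \<in> C \<Longrightarrow> norm ((f ^^ n) z) \<le> B n" by metis
  define K where "K = Max (B ` {..<j})"
  have "\<exists>z\<in>C. norm ((f ^^ n) z) \<le> K" for n
  proof (induction n rule: less_induct)
    case (less n)
    show ?case
    proof (cases "n < j")
      case True
      obtain z where z: "z \<in> C" using C by blast
      have "norm ((f ^^ n) z) \<le> B n" by (rule B[OF z])
      also have "\<dots> \<le> K" unfolding K_def using True by (intro Max_ge) auto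
      finally show ?thesis using z by blast
    next
      case False
      then obtain y where y: "y \<in> C" "norm ((f ^^ (n - j)) y) \<le> K"
        using less.IH[of "n - j"] j by auto
      then obtain z where "z \<in> C" "y = (f ^^ j) z" using cov by blast
      then show ?thesis
        using y False funpow_add[of "n - j" j f] by (intro bexI[of _ z]) auto
    qed
  qed
  then show thesis by (rule that)
qed

text \<open>If \<open>p\<close> is fixed, it has a bounded orbit itself. Otherwise a small closed disc \<open>A\<close> about \<open>p\<close> is
  disjoint from \<open>f(A)\<close>, and the covering property applies to these two sets. Taking \<open>k \<ge> 2\<close> excludes
  the vacuous coverings \<open>f\<^sup>0(A) = A\<close> and \<open>f\<^sup>1(A) = f(A)\<close>. If \<open>f\<^sup>k(A)\<close> contains \<open>f(A)\<close>, then \<open>f(A)\<close> is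
  contained in its own image under \<open>f\<^sup>k\<^sup>-\<^sup>1\<close>.\<close>

lemma julia_set_bounded_minima:
  assumes f: "f holomorphic_on UNIV" and p: "p \<in> julia_set f" and r: "r > 0"
  obtains K where "\<And>n. \<exists>z\<in>cball p r. norm ((f ^^ n) z) \<le> K"
proof (cases "f p = p")
  case True
  have "(f ^^ n) p = p" for n by (induction n) (auto simp: True)
  then show thesis using r by (intro that[of "norm p"]) (auto intro!: bexI[of _ p])
next
  case False
  have cf: "continuous_on UNIV f" using f by (rule holomorphic_on_imp_continuous_on)
  have "\<exists>s>0. s \<le> r \<and> cball p s \<inter> f ` cball p s = {}"
  proof -
    define e where "e = dist p (f p) / 2"
    have e: "e > 0" using False by (simp add: e_def)
    have "isCont f p" using cf by (simp add: continuous_on_eq_continuous_at)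
    then obtain d where d: "d > 0" "\<And>x. dist x p < d \<Longrightarrow> dist (f x) (f p) < e"
      using e by (metis continuous_at_eps_delta)
    define s where "s = Min {r, d / 2, e}"
    have s: "s > 0" "s \<le> r" "s \<le> d / 2" "s \<le> e"
      unfolding s_def using r d e by auto
    have "x \<noteq> f y" if "x \<in> cball p s" "y \<in> cball p s" for x y
    proof
      assume "x = f y"
      moreover have "dist (f y) (f p) < e"
        by (rule d(2)) (use that s d(1) in \<open>auto simp: dist_commute\<close>)
      moreover have "dist p x \<le> e" using that s by simp
      ultimately show False
        using dist_triangle[of p "f p" x] by (simp add: e_def)
    qed
    then show ?thesis using s by blast
  qed
  then obtain s where s: "s > 0" "s \<le> r" "cball p s \<inter> f ` cball p s = {}" by blast
  define A where "A = cball p s"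
  have A: "compact A" "A \<noteq> {}" "p \<in> A" using s by (auto simp: A_def)
  have fA: "compact (f ` A)"
    using A cf by (meson compact_continuous_image continuous_on_subset subset_UNIV)
  obtain k where k: "k \<ge> 2" "A \<subseteq> (f ^^ k) ` ball p s \<or> f ` A \<subseteq> (f ^^ k) ` ball p s"
    using julia_set_covering[OF f p s(1) A(1) fA] s(3) unfolding A_def by metis
  have sub: "ball p s \<subseteq> A" by (auto simp: A_def)
  have Ar: "A \<subseteq> cball p r" using s by (auto simp: A_def)
  from k(2) show thesis
  proof
    assume "A \<subseteq> (f ^^ k) ` ball p s"
    then have "A \<subseteq> (f ^^ k) ` A" using sub by blast
    then obtain K where K: "\<And>n. \<exists>z\<in>A. norm ((f ^^ n) z) \<le> K"
      using self_covering_imp_bounded_minima[OF cf A(1,2), of k] k(1) by auto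
    show thesis by (rule that[of K]) (use K Ar in blast)
  next
    assume "f ` A \<subseteq> (f ^^ k) ` ball p s"
    then have "f ` A \<subseteq> (f ^^ k) ` A" using sub by blast
    also have "(f ^^ k) ` A = (f ^^ (k - 1)) ` (f ` A)"
      using k(1) funpow_Suc_right[of "k - 1" f] by (simp add: image_comp)
    finally have cov: "f ` A \<subseteq> (f ^^ (k - 1)) ` (f ` A)" .
    have ne: "f ` A \<noteq> {}" using A(2) by simp
    have k1: "k - 1 \<ge> 1" using k(1) by simp
    obtain K where K: "\<And>n. \<exists>z\<in>f ` A. norm ((f ^^ n) z) \<le> K"
      by (rule self_covering_imp_bounded_minima[OF cf fA ne k1 cov]) blast
    have "\<exists>z\<in>cball p r. norm ((f ^^ n) z) \<le> max K (norm p)" for n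
    proof (cases n)
      case 0
      then show ?thesis using r by (intro bexI[of _ p]) auto
    next
      case (Suc m)
      obtain z where "z \<in> A" "norm ((f ^^ m) (f z)) \<le> K" using K by blast
      then show ?thesis using Ar Suc by (intro bexI[of _ z]) (auto simp: funpow_swap1)
    qed
    then show thesis by (rule that)
  qed
qed

text \<open>Some image \<open>f\<^sup>k(D)\<close> of the disc contains one of the circles of radius \<open>\<rho>\<close> and \<open>2\<rho>\<close>, hence a
  preimage in \<open>D\<close> of a point where \<open>|f\<^sup>j|\<close> is at least \<open>M(\<rho>, f\<^sup>j)\<close>. The index \<open>k\<close> is the same for
  all \<open>j\<close>.\<close>

lemma julia_set_fast_growth:
  assumes f: "f holomorphic_on UNIV" and p: "p \<in> julia_set f" and r: "r > 0"
    and \<rho>: "\<rho> > 0"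
  obtains k where "\<And>j. \<exists>w\<in>ball p r. max_modulus \<rho> (f ^^ j) \<le> norm ((f ^^ (k + j)) w)"
proof -
  have "sphere 0 \<rho> \<inter> sphere 0 (2 * \<rho>) = ({} :: complex set)" using \<rho> by auto
  then obtain k where "sphere 0 \<rho> \<subseteq> (f ^^ k) ` ball p r \<or> sphere 0 (2 * \<rho>) \<subseteq> (f ^^ k) ` ball p r"
    using julia_set_covering[OF f p r compact_sphere compact_sphere] by metis
  then obtain t where t: "\<rho> \<le> t" "sphere 0 t \<subseteq> (f ^^ k) ` ball p r"
    using \<rho> by (metis less_eq_real_def mult_2 less_add_same_cancel1)
  have "\<exists>w\<in>ball p r. max_modulus \<rho> (f ^^ j) \<le> norm ((f ^^ (k + j)) w)" for j
  proof -
    obtain y where y: "norm y = t" "norm ((f ^^ j) y) = max_modulus t (f ^^ j)"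
      using max_modulus_attained[OF holomorphic_on_imp_continuous_on[OF holomorphic_on_funpow[OF f]], of t j]
        t \<rho> by (metis less_eq_real_def order_trans)
    then obtain w where w: "w \<in> ball p r" "y = (f ^^ k) w"
      using t(2) by (metis imageE mem_sphere_0 subsetD)
    have "max_modulus \<rho> (f ^^ j) \<le> max_modulus t (f ^^ j)"
      by (rule max_modulus_mono[OF holomorphic_on_funpow[OF f]]) (use \<rho> t in auto)
    also have "\<dots> = norm ((f ^^ (k + j)) w)"
      using y w by (simp add: add.commute[of k] funpow_add)
    finally show ?thesis using w by blast
  qed
  then show thesis by (rule that)
qed

section \<open>Growth of the spherical derivative\<close>

theorem theorem1p1:
  fixes f :: "complex \<Rightarrow> complex" and U :: "complex set" and R :: real
  assumes "f holomorphic_on UNIV"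
    and "\<not> f constant_on UNIV"
    and "\<not> (\<exists>p :: complex poly. degree p = 1 \<and> f = poly p)"
    and "open U"
    and "U \<inter> julia_set f \<noteq> {}"
    and "R > 0"
  shows "\<exists>m :: nat. \<forall>\<^sub>F n in sequentially.
           sup_spherical_deriv U (f ^^ n) \<ge> ereal (ln (max_modulus_iter (n - m) R f))"
proof -
  note f = assms(1)
  have nonaff: "\<not> (\<exists>a b. \<forall>z. f z = a + b * z)"
  proof
    assume "\<exists>a b. \<forall>z. f z = a + b * z"
    then obtain a b where ab: "\<And>z. f z = a + b * z" by blast
    show False
    proof (cases "b = 0")
      case True
      then show False using assms(2) ab by (auto simp: constant_on_def)
    next
      case False
      then have "degree [:a, b:] = 1" by simp
      moreover have "f = poly [:a, b:]" by (auto simp: ab mult.commute)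
      ultimately show False using assms(3) by blast
    qed
  qed
  obtain p where p: "p \<in> U" "p \<in> julia_set f" using assms(5) by blast
  obtain r' where r': "r' > 0" "cball p r' \<subseteq> U" using assms(4) p open_contains_cball by blast
  define r where "r = r' / 3"
  have r: "r > 0" "cball p (3 * r) \<subseteq> U" using r' by (auto simp: r_def)
  obtain r1 where r1: "r1 \<ge> exp 1" "\<And>s. s \<ge> r1 \<Longrightarrow> s \<le> max_modulus s f"
    "\<And>s. s \<ge> r1 \<Longrightarrow> 3 / 2 * ln s \<le> ln (max_modulus s f)"
    by (rule max_modulus_log_growth[OF f nonaff]) blast
  obtain \<beta> r2 where \<beta>: "\<beta> \<ge> 1"
    and iter: "\<And>s j. s \<ge> r2 \<Longrightarrow> max_modulus_iter j s f \<le> max_modulus (\<beta> * s) (f ^^ j)"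
    by (rule max_modulus_funpow_ge_iter[OF f nonaff]) blast
  \<comment> \<open>Enlarging the radius only strengthens the claim, and from \<open>S\<close> on the iterates increase.\<close>
  define S where "S = Max {R, r1, r2}"
  have S: "R \<le> S" "r1 \<le> S" "r2 \<le> S" unfolding S_def by auto
  have S0: "S > 0" using S assms(6) by linarith
  obtain K0 where K0: "\<And>n. \<exists>z\<in>cball p r. norm ((f ^^ n) z) \<le> K0"
    using julia_set_bounded_minima[OF f p(2) r(1)] by metis
  define K where "K = max K0 1"
  have K: "K \<ge> 1" and bounded: "\<And>n. \<exists>z\<in>cball p r. norm ((f ^^ n) z) \<le> K"
    using K0 unfolding K_def by (simp, meson le_max_iff_disj)
  obtain k where k: "\<And>j. \<exists>w\<in>ball p r. max_modulus (\<beta> * S) (f ^^ j) \<le> norm ((f ^^ (k + j)) w)"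
    using julia_set_fast_growth[OF f p(2) r(1), of "\<beta> * S"] \<beta> S0 by auto
  define A where "A = 4 * r * (1 + K\<^sup>2) / K"
  have A: "A > 0" unfolding A_def using r K by (intro divide_pos_pos mult_pos_pos) (auto intro: add_pos_nonneg)
  \<comment> \<open>\<open>q\<close> extra iterations pay for the constants: they gain the factor \<open>(3 / 2) ^ q\<close>.\<close>
  obtain q where q: "A + ln K < (3 / 2) ^ q"
    using real_arch_pow[of "3 / 2 :: real"] by auto
  have "ereal (ln (max_modulus_iter (n - (k + q)) R f)) \<le> sup_spherical_deriv U (f ^^ n)"
    if n: "n \<ge> k + q" for n
  proof -
    define j where "j = n - (k + q)"
    have nj: "n = k + (j + q)" using n by (simp add: j_def)
    define L where "L = ln (max_modulus_iter j S f)"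
    have itS: "r1 \<le> max_modulus_iter i S f" for i
      by (rule max_modulus_iter_log_growth(1)[OF r1 S(2)])
    have itS0: "0 < max_modulus_iter i S f" for i
      using itS[of i] r1(1) exp_gt_zero[of "1::real"] by linarith
    have L: "L \<ge> 1" unfolding L_def using itS[of j] r1(1) itS0[of j] by (simp add: ln_ge_iff)
    obtain w where w: "w \<in> ball p r" "max_modulus (\<beta> * S) (f ^^ (j + q)) \<le> norm ((f ^^ n) w)"
      using k[of "j + q"] nj by blast
    have wM: "max_modulus_iter (j + q) S f \<le> norm ((f ^^ n) w)"
      using iter[OF S(3)] w(2) by (rule order_trans)
    have gw: "norm ((f ^^ n) w) > 0" using wM itS0[of "j + q"] by linarith
    have "A * L + ln K \<le> A * L + ln K * L"
      using L K mult_left_mono[of 1 L "ln K"] by simp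
    also have "\<dots> \<le> (3 / 2) ^ q * L"
      using mult_right_mono[of "A + ln K" "(3 / 2) ^ q" L] q L by (simp add: algebra_simps)
    also have "\<dots> \<le> ln (max_modulus_iter (j + q) S f)"
      unfolding L_def by (rule max_modulus_iter_log_growth(2)[OF r1 S(2)])
    also have "\<dots> \<le> ln (norm ((f ^^ n) w))"
      using wM itS0[of "j + q"] gw by simp
    finally have AL: "A * L \<le> ln (norm ((f ^^ n) w) / K)"
      using gw K by (simp add: ln_div)
    have "0 < A * L" using A L by simp
    then have "0 < ln (norm ((f ^^ n) w) / K)" using AL by linarith
    then have wK: "norm ((f ^^ n) w) > K"
      using gw K by (simp add: ln_gt_zero_iff)
    obtain z where z: "z \<in> cball p r" "norm ((f ^^ n) z) \<le> K" using bounded by blast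
    obtain \<zeta> where \<zeta>: "\<zeta> \<in> U" "ln (norm ((f ^^ n) w) / K) \<le> A * spherical_deriv (f ^^ n) \<zeta>"
      unfolding A_def
    proof (rule spherical_deriv_lower_bound[OF r(2) _ assms(4) _ z _ wK])
      show "(f ^^ n) holomorphic_on U"
        using holomorphic_on_funpow[OF f] by (rule holomorphic_on_subset) simp
    qed (use K w in auto)
    have "A * L \<le> A * spherical_deriv (f ^^ n) \<zeta>" using AL \<zeta>(2) by linarith
    then have LS: "L \<le> spherical_deriv (f ^^ n) \<zeta>" using A by simp
    have RS: "0 \<le> max_modulus_iter j R f" "max_modulus_iter j R f \<le> max_modulus_iter j S f"
      using max_modulus_iter_mono[OF f, of R S j] assms(6) S by auto
    have "ln (max_modulus_iter j R f) \<le> L"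
    \<comment> \<open>The iterates from \<open>R\<close> may vanish, where \<open>ln 0 = 0\<close> by convention.\<close>
    proof (cases "max_modulus_iter j R f = 0")
      case True
      then show ?thesis using L by simp
    next
      case False
      then show ?thesis using RS unfolding L_def by simp
    qed
    then have "ereal (ln (max_modulus_iter j R f)) \<le> ereal (spherical_deriv (f ^^ n) \<zeta>)"
      using LS by simp
    also have "\<dots> \<le> sup_spherical_deriv U (f ^^ n)"
      unfolding sup_spherical_deriv_def using \<zeta>(1) by (rule SUP_upper)
    finally show ?thesis by (simp add: j_def)
  qed
  then show ?thesis
    unfolding eventually_sequentially by (intro exI[of _ "k + q"]) blast
qed

end
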